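(* Let $\mathrm{Re}(x)>0$. Then $$T(x)=\frac14\left\{\mathscr{F}(x;i,i)+\mathscr{F}(x;-i,-i)-\mathscr{F}(x;i,-i)-\mathscr{F}(x;-i,i)\right\}.$$
   Context: For $\mathrm{Re}(x)>0$, $T(x)=\int_0^1\frac{\tan^{-1}(t^x)}{1+t^2}\,dt$ (principal branch of $\tan^{-1}$). For $\mathrm{Re}(x)>0$, $u\in\mathbb{C}\setminus(1,\infty)$, $u\ne0$, and $v\in\mathbb{C}\setminus[1,\infty)$, $v\neq0$, $\mathscr{F}(x;u,v)=\int_0^1\frac{\log(1-ut^x)}{v^{-1}-t}\,dt$ (principal logarithm). *)

theory Defs
  imports "HOL-Analysis.Analysis"
begin

text \<open>
  Intended domain: \<open>Re x > 0\<close>. \<open>Arctan\<close> and \<open>Ln\<close> are the library's principal branches,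
  and \<open>t powr x = exp (x * Ln t)\<close> for \<open>t > 0\<close>, with value \<open>0\<close> at \<open>t = 0\<close>, the limit of
  \<open>t\<^sup>x\<close> at \<open>0\<close> when \<open>Re x > 0\<close>.
\<close>

definition T :: "complex \<Rightarrow> complex" where
  "T x = integral {0..1} (\<lambda>t::real. Arctan (of_real t powr x) / (1 + (of_real t)\<^sup>2))"

text \<open>
  Intended domain: \<open>Re x > 0\<close>, \<open>u \<noteq> 0\<close> outside the real ray \<open>(1, \<infinity>)\<close>, and \<open>v \<noteq> 0\<close> outside
  the real ray \<open>[1, \<infinity>)\<close>.
\<close>

definition F :: "complex \<Rightarrow> complex \<Rightarrow> complex \<Rightarrow> complex" where
  "F x u v = integral {0..1}
     (\<lambda>t::real. Ln (1 - u * of_real t powr x) / (inverse v - of_real t))"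

end

theory Submission
  imports Defs
begin

text \<open>
  The identity already holds between the integrands. By partial fractions,
  \<open>1/(-\<i> - t) - 1/(\<i> - t) = 2\<i>/(1 + t\<^sup>2)\<close>, where \<open>-\<i>\<close> and \<open>\<i>\<close> are the inverses of the two
  values \<open>\<i>\<close> and \<open>-\<i>\<close> of \<open>v\<close>; so the signed combination of the four integrands is
  \<open>2\<i> (Ln (1 - \<i> w) - Ln (1 + \<i> w)) / (1 + t\<^sup>2)\<close> with \<open>w = t powr x\<close>. Up to a factor of \<open>4\<close>
  this is \<open>Arctan w / (1 + t\<^sup>2)\<close>, provided that the logarithm of the quotient
  \<open>(1 - \<i> w) / (1 + \<i> w)\<close> defining \<open>Arctan w\<close> splits (\<open>Arctan_eq_Ln_diff\<close>).

  Both this splitting and the existence of the four integrals rest on one fact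
  (\<open>abs_Im_powr_less_1\<close>): for \<open>0 \<le> t \<le> 1\<close> the number \<open>w\<close> lies in the strip \<open>\<bar>Im w\<bar> < 1\<close>. There
  \<open>1 \<plusminus> \<i> w\<close> has positive real part, so the arguments of both numbers are below \<open>pi/2\<close> in
  absolute value, and all integrands are continuous on the closed interval.
\<close>

text \<open>
  The closed unit disc meets the lines \<open>\<bar>Im w\<bar> = 1\<close> only at \<open>\<plusminus>\<i>\<close>, and \<open>t powr x\<close> avoids these points:
  it has modulus below \<open>1\<close> for \<open>t < 1\<close>, and it equals \<open>1\<close> for \<open>t = 1\<close>.
\<close>

lemma abs_Im_powr_less_1:
  fixes x :: complex and t :: real
  assumes "Re x > 0" "0 \<le> t" "t \<le> 1"
  shows "\<bar>Im (of_real t powr x)\<bar> < 1"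
proof (cases "t = 1")
  case False
  have "norm (of_real t powr x) = t powr Re x"
    using assms by (simp add: norm_powr_real_powr)
  also have "\<dots> < 1"
    using assms False powr_less_mono2[of "Re x" t 1] by simp
  finally show ?thesis
    using abs_Im_le_cmod le_less_trans by blast
qed simp

lemma Ln_divide_Re_pos:
  assumes "Re w > 0" "Re z > 0"
  shows "Ln (w / z) = Ln w - Ln z"
proof -
  have "w \<noteq> 0" "z \<noteq> 0"
    using assms by auto
  moreover have "\<bar>Im (Ln w)\<bar> < pi / 2" "\<bar>Im (Ln z)\<bar> < pi / 2"
    using assms by (blast intro: Re_Ln_pos_lt_imp)+
  ultimately show ?thesis
    by (intro Ln_unique) (auto simp: exp_diff)
qed

lemma Arctan_eq_Ln_diff:
  assumes "\<bar>Im w\<bar> < 1"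
  shows "Arctan w = \<i> / 2 * (Ln (1 - \<i> * w) - Ln (1 + \<i> * w))"
  unfolding Arctan_def using assms by (subst Ln_divide_Re_pos) auto

text \<open>
  Only values of \<open>u\<close> for which \<open>1 - u w\<close> has positive real part on the whole strip
  \<open>\<bar>Im w\<bar> < 1\<close> are admitted, so that no branch cut is met; the denominator is nonzero because
  \<open>inverse v\<close> is not real.
\<close>

lemma F_integrable:
  fixes x u v :: complex
  assumes "Re x > 0" and u: "u = \<i> \<or> u = - \<i>" and v: "v = \<i> \<or> v = - \<i>"
  shows "(\<lambda>t::real. Ln (1 - u * of_real t powr x) / (inverse v - of_real t))
           integrable_on {0..1}"
proof (rule integrable_continuous_real)
  have "1 - u * of_real t powr x \<notin> \<real>\<^sub>\<le>\<^sub>0" if "t \<in> {0..1}" for t :: real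
    using abs_Im_powr_less_1[of x t] assms that
    by (auto simp: complex_nonpos_Reals_iff)
  moreover have "inverse v - of_real t \<noteq> 0" for t :: real
    using v by (auto simp: complex_eq_iff)
  \<comment> \<open>At \<open>t = 0\<close>, continuity of \<open>t powr x\<close> needs \<open>Re x > 0\<close>.\<close>
  ultimately show "continuous_on {0..1}
      (\<lambda>t::real. Ln (1 - u * of_real t powr x) / (inverse v - of_real t))"
    using assms by (intro continuous_intros) auto
qed

lemma Arctan_integrand_eq:
  fixes w :: complex and t :: real
  assumes "\<bar>Im w\<bar> < 1"
  shows "Arctan w / (1 + (of_real t)\<^sup>2) = 1 / 4 *
    (Ln (1 - \<i> * w) / (inverse \<i> - of_real t) + Ln (1 - (- \<i>) * w) / (inverse (- \<i>) - of_real t)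
     - Ln (1 - \<i> * w) / (inverse (- \<i>) - of_real t) - Ln (1 - (- \<i>) * w) / (inverse \<i> - of_real t))"
proof -
  define a b s where "a = Ln (1 - \<i> * w)" and "b = Ln (1 + \<i> * w)" and "s = complex_of_real t"
  have nz: "- \<i> - s \<noteq> 0" "\<i> - s \<noteq> 0"
    by (auto simp: s_def complex_eq_iff)
  have prod: "(- \<i> - s) * (\<i> - s) = 1 + s\<^sup>2"
    by (simp add: algebra_simps power2_eq_square)
  have "1 / (- \<i> - s) - 1 / (\<i> - s) = 2 * \<i> / ((- \<i> - s) * (\<i> - s))"
    using nz by (simp add: diff_frac_eq)
  then have pf: "1 / (- \<i> - s) - 1 / (\<i> - s) = 2 * \<i> / (1 + s\<^sup>2)"
    unfolding prod .
  have scale: "(a - b) * (2 * \<i> / d) = 4 * ((\<i> / 2 * (a - b)) / d)" for d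
    by (cases "d = 0") (simp_all add: field_simps)
  have "a / (- \<i> - s) + b / (\<i> - s) - a / (\<i> - s) - b / (- \<i> - s)
      = (a - b) * (1 / (- \<i> - s) - 1 / (\<i> - s))"
    by (simp add: algebra_simps diff_divide_distrib)
  also have "\<dots> = 4 * ((\<i> / 2 * (a - b)) / (1 + s\<^sup>2))"
    unfolding pf by (rule scale)
  finally show ?thesis
    using assms by (simp add: Arctan_eq_Ln_diff a_def b_def s_def)
qed

theorem theorem4p1:
  fixes x :: complex
  assumes "Re x > 0"
  shows "T x = 1 / 4 * (F x \<i> \<i> + F x (- \<i>) (- \<i>) - F x \<i> (- \<i>) - F x (- \<i>) \<i>)"
proof -
  define f where "f u v t = Ln (1 - u * of_real t powr x) / (inverse v - of_real t)"
    for u v :: complex and t :: real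
  have F: "(f u v has_integral F x u v) {0..1}" if "u = \<i> \<or> u = - \<i>" "v = \<i> \<or> v = - \<i>" for u v
    using F_integrable[OF assms that] unfolding f_def F_def
    by (simp add: integrable_integral)
  have "((\<lambda>t. 1 / 4 * (f \<i> \<i> t + f (- \<i>) (- \<i>) t - f \<i> (- \<i>) t - f (- \<i>) \<i> t)) has_integral
      1 / 4 * (F x \<i> \<i> + F x (- \<i>) (- \<i>) - F x \<i> (- \<i>) - F x (- \<i>) \<i>)) {0..1}"
    by (intro has_integral_mult_right has_integral_diff has_integral_add F) auto
  then have "((\<lambda>t. Arctan (of_real t powr x) / (1 + (of_real t)\<^sup>2)) has_integral
      1 / 4 * (F x \<i> \<i> + F x (- \<i>) (- \<i>) - F x \<i> (- \<i>) - F x (- \<i>) \<i>)) {0..1}"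
    unfolding f_def
    by (rule has_integral_eq[rotated])
       (rule Arctan_integrand_eq[symmetric], use assms in \<open>auto intro: abs_Im_powr_less_1\<close>)
  then show ?thesis
    unfolding T_def by (rule integral_unique)
qed

end
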